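(* Let $G$ be a connected graph, and let $\alpha(G)$ denote the minimum size of a connected vertex cover of $G$. Then $$t_3(G)\le \begin{cases} 1+3\alpha(G), & \text{if } \alpha(G)=1,\\ 3\alpha(G), & \text{if } \alpha(G)=2,\\ 2\alpha(G)+2, & \text{if } \alpha(G)\ge 3.\end{cases}$$ Moreover, these bounds are sharp, i.e. in each of the three cases there is a connected graph $G$ attaining equality.
   Context: All graphs are finite, simple and undirected. $N_G(v)$ is the open neighborhood of $v$. A vertex coloring of $G$ is any assignment $f$ of colors to the vertices (adjacent vertices may receive the same color). For an integer $i\ge 2$, $f$ is an $N_i$-vertex coloring if $|\{f(x): x\in N_G(v)\}|\le i$ for every $v\in V(G)$. The $N_i$-chromatic number $t_i(G)$ is the maximum number of colors used in an $N_i$-vertex coloring of $G$. A vertex cover of $G$ is a set $S\subseteq V(G)$ such that every edge has at least one end-vertex in $S$; it is a connected vertex cover if the induced subgraph $G[S]$ is connected. $\alpha(G)$ is the minimum of $|S|$ over all connected vertex covers $S$ of $G$ (this is not the independence number). *)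

theory Defs
  imports "Graph_Theory.Graph_Theory"
begin

text \<open>
  Finite simple undirected graphs are represented by the locale \<open>pair_graph\<close> (finite, loop-free,
  symmetric arc relation); an edge \<open>uv\<close> is the pair of arcs \<open>(u, v)\<close>, \<open>(v, u)\<close>.
\<close>

definition open_neighborhood :: "'a pair_pre_digraph \<Rightarrow> 'a \<Rightarrow> 'a set" where
  "open_neighborhood G v = {u. (v, u) \<in> parcs G}"

definition N_vertex_coloring :: "nat \<Rightarrow> 'a pair_pre_digraph \<Rightarrow> ('a \<Rightarrow> nat) \<Rightarrow> bool" where
  "N_vertex_coloring i G f \<longleftrightarrow> (\<forall>v \<in> pverts G. card (f ` open_neighborhood G v) \<le> i)"

text \<open>
  Taking natural numbers as colors loses no generality, since \<open>G\<close> is finite. The set below is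
  finite (bounded by the number of vertices) and, for \<open>i \<ge> 1\<close>, nonempty (constant colorings).
\<close>

definition N_chromatic_number :: "nat \<Rightarrow> 'a pair_pre_digraph \<Rightarrow> nat" where
  "N_chromatic_number i G = Max {card (f ` pverts G) | f. N_vertex_coloring i G f}"

definition vertex_cover :: "'a pair_pre_digraph \<Rightarrow> 'a set \<Rightarrow> bool" where
  "vertex_cover G S \<longleftrightarrow> S \<subseteq> pverts G \<and> (\<forall>(u, v) \<in> parcs G. u \<in> S \<or> v \<in> S)"

text \<open>
  The library's \<open>connected\<close> requires a nonempty vertex set. Hence a connected vertex cover is
  nonempty, which matters only for the one-vertex graph (whose \<open>\<alpha>\<close> is then 1). The constant is
  qualified because of the topological constant of the same name.
\<close>

definition connected_vertex_cover :: "'a pair_pre_digraph \<Rightarrow> 'a set \<Rightarrow> bool" where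
  "connected_vertex_cover G S \<longleftrightarrow>
     vertex_cover G S \<and> Digraph_Component.connected (with_proj G \<restriction> S)"

text \<open>Meaningful for connected \<open>G\<close>, where \<open>pverts G\<close> itself is a connected vertex cover.\<close>

definition connected_cover_number :: "'a pair_pre_digraph \<Rightarrow> nat" where
  "connected_cover_number G = Min {card S | S. connected_vertex_cover G S}"

end

theory Submission
  imports Defs
begin

text \<open>
  All three cases of the bound are the single inequality \<open>t\<^sub>3 \<le> 2\<alpha> + 2\<close>, for \<open>2\<alpha> + 2\<close> equals
  \<open>1 + 3\<alpha>\<close> at \<open>\<alpha> = 1\<close> and \<open>3\<alpha>\<close> at \<open>\<alpha> = 2\<close>.

  For the upper bound, explore a connected vertex cover \<open>S\<close> one vertex at a time, each new vertex
  being adjacent to an earlier one, and count the colors on the closed neighborhood of the explored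
  part (\<open>connected_set_few_colors\<close>). The first vertex contributes at most \<open>1 + 3\<close> colors. A later
  vertex \<open>v\<close>, reached from \<open>u\<close>, lies in the neighborhood of \<open>u\<close>, so its own color has been
  counted; and \<open>u\<close> lies in the neighborhood of \<open>v\<close>, so at most two of the three colors there are
  new. Once \<open>S\<close> is exhausted, every vertex has been counted, because \<open>S\<close> covers all edges
  of a connected graph.

  For sharpness, take a path on \<open>a\<close> vertices and hang leaves on it until every path vertex has
  degree three. The resulting caterpillar has \<open>2a + 2\<close> vertices, and the coloring with all colors
  distinct is legal, so \<open>t\<^sub>3 = 2a + 2\<close>. The path is a connected vertex cover of size \<open>a\<close>; that there
  is no smaller one follows from the upper bound itself, since \<open>2a + 2 = t\<^sub>3 \<le> 2\<alpha> + 2\<close>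
  (\<open>bounded_degree_extremal\<close>).
\<close>

section \<open>Connectedness by cuts\<close>

text \<open>
  The cut form is the one in which connectedness is used below: it yields directly the next vertex
  of an exploration. In the direction from right to left, the cut is taken around the set of vertices
  reachable from a given one.
\<close>

lemma connected_induced_iff_cut:
  assumes sym: "sym (parcs G)"
  shows "Digraph_Component.connected (with_proj G \<restriction> S) \<longleftrightarrow>
    S \<noteq> {} \<and> (\<forall>T \<subseteq> S. T \<noteq> {} \<longrightarrow> T \<noteq> S \<longrightarrow> (\<exists>u \<in> T. \<exists>v \<in> S - T. (u, v) \<in> parcs G))"
    (is "?L \<longleftrightarrow> ?R")
proof -
  let ?E = "(arcs_ends (with_proj G \<restriction> S))\<^sup>s"
  have E: "?E = parcs G \<inter> S \<times> S"
    using sym by (auto simp: arcs_ends_conv symcl_def sym_def image_iff)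
  have conn: "?L \<longleftrightarrow> S \<noteq> {} \<and> (\<forall>u \<in> S. \<forall>v \<in> S. (u, v) \<in> rtrancl_on S (parcs G \<inter> S \<times> S))"
    unfolding connected_conv E by simp
  show ?thesis
  proof
    assume ?L
    show ?R
    proof (intro conjI allI impI)
      show "S \<noteq> {}" using \<open>?L\<close> conn by blast
    next
      fix T assume T: "T \<subseteq> S" "T \<noteq> {}" "T \<noteq> S"
      then obtain u w where uw: "u \<in> T" "w \<in> S" "w \<notin> T" by blast
      then have "(u, w) \<in> rtrancl_on S (parcs G \<inter> S \<times> S)"
        using \<open>?L\<close> conn T by blast
      then have "w \<in> T \<or> (\<exists>u \<in> T. \<exists>v \<in> S - T. (u, v) \<in> parcs G)"
        by (induction rule: rtrancl_on_induct) (use uw in auto)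
      then show "\<exists>u \<in> T. \<exists>v \<in> S - T. (u, v) \<in> parcs G" using uw by blast
    qed
  next
    assume ?R
    have "(u, v) \<in> rtrancl_on S (parcs G \<inter> S \<times> S)" if uv: "u \<in> S" "v \<in> S" for u v
    proof -
      define T where "T = {w. (u, w) \<in> rtrancl_on S (parcs G \<inter> S \<times> S)}"
      have "T \<subseteq> S" "u \<in> T"
        using uv by (auto simp: T_def dest: in_rtrancl_on_in_F)
      moreover have "y \<in> T" if "x \<in> T" "y \<in> S" "(x, y) \<in> parcs G" for x y
        using that \<open>T \<subseteq> S\<close> unfolding T_def by (auto intro: rtrancl_on_into_rtrancl_on)
      ultimately have "T = S" using \<open>?R\<close> by blast
      then show ?thesis using uv by (auto simp: T_def)
    qed
    then show ?L using conn \<open>?R\<close> by blast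
  qed
qed

lemma (in pair_wf_digraph) induce_pverts: "with_proj G \<restriction> pverts G = with_proj G"
  by (auto simp: induce_subgraph_def with_proj_def dest: in_arcsD1 in_arcsD2)

lemma (in pair_sym_digraph) sym_parcs: "sym (parcs G)"
  using pair_sym_arcs by (simp add: symmetric_def)

lemma (in pair_sym_digraph) connected_iff_cut:
  "Digraph_Component.connected (with_proj G) \<longleftrightarrow>
    pverts G \<noteq> {} \<and> (\<forall>T \<subseteq> pverts G. T \<noteq> {} \<longrightarrow> T \<noteq> pverts G \<longrightarrow>
      (\<exists>u \<in> T. \<exists>v \<in> pverts G - T. (u, v) \<in> parcs G))"
  using connected_induced_iff_cut[OF sym_parcs, of "pverts G"] by (simp add: induce_pverts)

text \<open>
  A numbering in which every vertex except a root has a smaller neighbor certifies connectedness: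
  of the two sides of a cut, the least vertex on the side without the root has a neighbor on the
  other side.
\<close>

lemma connected_induced_if_smaller_neighbor:
  fixes G :: "'a::wellorder pair_pre_digraph"
  assumes sym: "sym (parcs G)" and "r \<in> S"
    and smaller: "\<And>v. v \<in> S \<Longrightarrow> v \<noteq> r \<Longrightarrow> \<exists>u \<in> S. u < v \<and> (u, v) \<in> parcs G"
  shows "Digraph_Component.connected (with_proj G \<restriction> S)"
proof -
  have cut: "\<exists>u \<in> S - A. \<exists>v \<in> A. (u, v) \<in> parcs G"
    if A: "A \<subseteq> S" "A \<noteq> {}" "r \<notin> A" for A
  proof -
    define m where "m = (LEAST x. x \<in> A)"
    have "m \<in> A" unfolding m_def using A(2) by (auto intro: LeastI)
    then obtain u where "u \<in> S" "u < m" "(u, m) \<in> parcs G" using A smaller by blast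
    moreover have "u \<notin> A" using \<open>u < m\<close> not_less_Least unfolding m_def by blast
    ultimately show ?thesis using \<open>m \<in> A\<close> by blast
  qed
  have "\<exists>u \<in> T. \<exists>v \<in> S - T. (u, v) \<in> parcs G" if T: "T \<subseteq> S" "T \<noteq> {}" "T \<noteq> S" for T
  proof (cases "r \<in> T")
    case True
    then have "\<exists>u \<in> S - (S - T). \<exists>v \<in> S - T. (u, v) \<in> parcs G"
      using T by (intro cut) auto
    then show ?thesis by blast
  next
    case False
    then have "\<exists>u \<in> S - T. \<exists>v \<in> T. (u, v) \<in> parcs G" using T by (intro cut) auto
    then show ?thesis using sym by (blast dest: symD)
  qed
  then show ?thesis using connected_induced_iff_cut[OF sym] \<open>r \<in> S\<close> by blast
qed

section \<open>The upper bound\<close>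

context pair_graph
begin

text \<open>
  The exploration argument, for neighborhoods with at most \<open>d + 1\<close> colors: the first vertex accounts
  for at most \<open>d + 2\<close> colors and every further one for at most \<open>d\<close> new ones.
\<close>

lemma connected_set_few_colors:
  assumes col: "N_vertex_coloring (Suc d) G f"
    and S: "S \<subseteq> pverts G" and conn: "Digraph_Component.connected (with_proj G \<restriction> S)"
  shows "card (f ` (S \<union> (\<Union>v \<in> S. open_neighborhood G v))) \<le> d * card S + 2"
proof -
  let ?N = "open_neighborhood G"
  let ?C = "\<lambda>T. T \<union> (\<Union>v \<in> T. ?N v)"
  have finS: "finite S" using S pair_finite_verts finite_subset by blast
  have N_sub: "?N v \<subseteq> pverts G" for v
    unfolding open_neighborhood_def using in_arcsD2 by blast
  have finN: "finite (?N v)" for v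
    using N_sub pair_finite_verts finite_subset by blast
  have cut: "S \<noteq> {} \<and> (\<forall>T \<subseteq> S. T \<noteq> {} \<longrightarrow> T \<noteq> S \<longrightarrow> (\<exists>u \<in> T. \<exists>v \<in> S - T. (u, v) \<in> parcs G))"
    using connected_induced_iff_cut[OF sym_parcs] conn by blast
  have colN: "card (f ` ?N v) \<le> Suc d" if "v \<in> S" for v
    using col S that unfolding N_vertex_coloring_def by blast
  have "\<exists>T \<subseteq> S. card T = Suc k \<and> card (f ` ?C T) \<le> d * Suc k + 2" if "Suc k \<le> card S" for k
    using that
  proof (induction k)
    case 0
    obtain s where s: "s \<in> S" using cut by blast
    have "card (f ` ?C {s}) \<le> Suc (card (f ` ?N s))"
      using finN by (simp add: card_insert_le_m1 card_insert_if)
    also have "\<dots> \<le> d * Suc 0 + 2" using colN[OF s] by simp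
    finally show ?case using s by (intro exI[of _ "{s}"]) auto
  next
    case (Suc k)
    then obtain T where T: "T \<subseteq> S" "card T = Suc k" "card (f ` ?C T) \<le> d * Suc k + 2"
      by auto
    have "T \<noteq> {}" "T \<noteq> S" using T Suc.prems by auto
    then obtain u v where uv: "u \<in> T" "v \<in> S" "v \<notin> T" "(u, v) \<in> parcs G"
      using cut T(1) by blast
    have finT: "finite T" using T(1) finS finite_subset by blast
    have fin: "finite (f ` ?C T)" "finite (f ` ?N v)" using finT finN by auto
    have "v \<in> ?N u" "u \<in> ?N v"
      using uv(4) arcs_symmetric by (auto simp: open_neighborhood_def)
    then have C: "f ` ?C (insert v T) = f ` ?C T \<union> f ` ?N v" and "f u \<in> f ` ?C T \<inter> f ` ?N v"
      using uv(1) by auto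
    then have "card (f ` ?C T \<inter> f ` ?N v) \<noteq> 0" using fin by auto
    then have "card (f ` ?C (insert v T)) + 1 \<le> card (f ` ?C T) + card (f ` ?N v)"
      unfolding C using card_Un_Int[OF fin] by linarith
    also have "\<dots> \<le> (d * Suc k + 2) + Suc d" using T(3) colN[OF uv(2)] by linarith
    finally have "card (f ` ?C (insert v T)) \<le> d * Suc (Suc k) + 2" by simp
    moreover have "card (insert v T) = Suc (Suc k)" using T(2) uv(3) finT by simp
    ultimately show ?case using T(1) uv(2) by (intro exI[of _ "insert v T"]) auto
  qed
  from this[of "card S - 1"] obtain T where
    "T \<subseteq> S" "card T = card S" "card (f ` ?C T) \<le> d * card S + 2"
    using finS cut by (auto simp: card_gt_0_iff Suc_le_eq)
  then show ?thesis using card_subset_eq[OF finS] by metis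
qed

text \<open>
  A vertex outside a cover has a neighbor, as the graph is connected and has other vertices, and
  that neighbor lies in the cover.
\<close>

lemma connected_vertex_cover_dominating:
  assumes conn: "Digraph_Component.connected (with_proj G)" and S: "connected_vertex_cover G S"
  shows "pverts G = S \<union> (\<Union>v \<in> S. open_neighborhood G v)"
proof
  have cover: "S \<subseteq> pverts G" "\<And>u v. (u, v) \<in> parcs G \<Longrightarrow> u \<in> S \<or> v \<in> S"
    using S by (auto simp: connected_vertex_cover_def vertex_cover_def)
  have "S \<noteq> {}"
    using S connected_induced_iff_cut[OF sym_parcs] by (auto simp: connected_vertex_cover_def)
  show "pverts G \<subseteq> S \<union> (\<Union>v \<in> S. open_neighborhood G v)"
  proof
    fix w assume w: "w \<in> pverts G"
    show "w \<in> S \<union> (\<Union>v \<in> S. open_neighborhood G v)"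
    proof (cases "w \<in> S")
      case False
      then have "{w} \<noteq> pverts G" using cover(1) \<open>S \<noteq> {}\<close> by (metis subset_singletonD insertI1)
      then obtain x where "(w, x) \<in> parcs G"
        using conn w unfolding connected_iff_cut by blast
      then have "x \<in> S" "(x, w) \<in> parcs G" using cover(2) False arcs_symmetric by auto
      then show ?thesis by (auto simp: open_neighborhood_def)
    qed simp
  qed
  show "S \<union> (\<Union>v \<in> S. open_neighborhood G v) \<subseteq> pverts G"
    using cover(1) in_arcsD2 by (auto simp: open_neighborhood_def)
qed

lemma finite_connected_cover_sizes: "finite {card S | S. connected_vertex_cover G S}"
proof -
  have "{card S | S. connected_vertex_cover G S} \<subseteq> card ` Pow (pverts G)"
    by (auto simp: connected_vertex_cover_def vertex_cover_def)
  then show ?thesis using pair_finite_verts finite_subset by blast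
qed

lemma connected_cover_number_attained:
  assumes "Digraph_Component.connected (with_proj G)"
  obtains S where "connected_vertex_cover G S" "card S = connected_cover_number G"
proof -
  have "connected_vertex_cover G (pverts G)"
    using assms in_arcsD1
    by (auto simp: connected_vertex_cover_def vertex_cover_def induce_pverts)
  then have "connected_cover_number G \<in> {card S | S. connected_vertex_cover G S}"
    unfolding connected_cover_number_def
    by (intro Min_in finite_connected_cover_sizes) blast
  then show ?thesis using that by auto
qed

lemma connected_cover_number_le:
  "connected_vertex_cover G S \<Longrightarrow> connected_cover_number G \<le> card S"
  unfolding connected_cover_number_def by (rule Min_le[OF finite_connected_cover_sizes]) blast

lemma finite_color_counts: "finite {card (f ` pverts G) | f. N_vertex_coloring i G f}"
proof -
  have "{card (f ` pverts G) | f. N_vertex_coloring i G f} \<subseteq> {..card (pverts G)}"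
    using pair_finite_verts card_image_le by blast
  then show ?thesis using finite_subset by blast
qed

lemma le_N_chromatic_number:
  "N_vertex_coloring i G f \<Longrightarrow> card (f ` pverts G) \<le> N_chromatic_number i G"
  unfolding N_chromatic_number_def by (rule Max_ge[OF finite_color_counts]) blast

lemma N_chromatic_number_attained:
  obtains f where "N_vertex_coloring (Suc d) G f" "card (f ` pverts G) = N_chromatic_number (Suc d) G"
proof -
  have "card ((\<lambda>_. 0::nat) ` A) \<le> Suc d" for A :: "'a set"
    by (simp add: image_constant_conv)
  then have "N_vertex_coloring (Suc d) G (\<lambda>_. 0)" by (simp add: N_vertex_coloring_def)
  then have "N_chromatic_number (Suc d) G \<in> {card (f ` pverts G) | f. N_vertex_coloring (Suc d) G f}"
    unfolding N_chromatic_number_def by (intro Max_in finite_color_counts) blast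
  then show ?thesis using that by auto
qed

lemma N_chromatic_number_le:
  assumes conn: "Digraph_Component.connected (with_proj G)"
  shows "N_chromatic_number (Suc d) G \<le> d * connected_cover_number G + 2"
proof -
  obtain S where S: "connected_vertex_cover G S" "card S = connected_cover_number G"
    using connected_cover_number_attained[OF conn] .
  obtain f where f: "N_vertex_coloring (Suc d) G f"
    "card (f ` pverts G) = N_chromatic_number (Suc d) G"
    using N_chromatic_number_attained .
  show ?thesis
    using connected_set_few_colors[OF f(1), of S] S f(2)
      connected_vertex_cover_dominating[OF conn S(1)]
    by (simp add: connected_vertex_cover_def vertex_cover_def)
qed

section \<open>Sharpness\<close>

text \<open>
  In a graph of maximum degree at most \<open>d + 1\<close> all vertices may receive distinct colors, so the upper bound
  reads \<open>\<bar>V\<bar> \<le> d\<alpha> + 2\<close>. When \<open>\<bar>V\<bar> = da + 2\<close>, it gives the lower bound \<open>a\<close> on \<open>\<alpha>\<close>.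
\<close>

lemma bounded_degree_extremal:
  assumes conn: "Digraph_Component.connected (with_proj G)"
    and deg: "\<And>v. v \<in> pverts G \<Longrightarrow> card (open_neighborhood G v) \<le> Suc d" and "d > 0"
    and S: "connected_vertex_cover G S" "card (pverts G) = d * card S + 2"
  shows "connected_cover_number G = card S"
    and "N_chromatic_number (Suc d) G = d * card S + 2"
proof -
  obtain f :: "'a \<Rightarrow> nat" where f: "inj_on f (pverts G)"
    using finite_imp_inj_to_nat_seg[OF pair_finite_verts] by blast
  have "finite (open_neighborhood G v)" for v
    by (rule finite_subset[OF _ pair_finite_verts])
      (auto simp: open_neighborhood_def dest: in_arcsD2)
  then have "N_vertex_coloring (Suc d) G f"
    unfolding N_vertex_coloring_def using deg card_image_le le_trans by blast
  then have lower: "d * card S + 2 \<le> N_chromatic_number (Suc d) G"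
    using le_N_chromatic_number[of "Suc d" f] S(2) card_image[OF f] by simp
  also note upper = N_chromatic_number_le[OF conn, of d]
  finally have "card S \<le> connected_cover_number G" using \<open>d > 0\<close> by simp
  then show "connected_cover_number G = card S" using connected_cover_number_le[OF S(1)] by simp
  then show "N_chromatic_number (Suc d) G = d * card S + 2" using lower upper by simp
qed

end

text \<open>
  The path is \<open>0, 1, \<dots>, a + 1\<close>; its inner vertices form the spine, its two ends are leaves, and the
  spine vertex \<open>i\<close> carries the further leaf \<open>a + 1 + i\<close>.
\<close>

definition caterpillar :: "nat \<Rightarrow> nat pair_pre_digraph" where
  "caterpillar a =
    (let E = {(i, i + 1) | i. i \<le> a} \<union> {(i, a + 1 + i) | i. 1 \<le> i \<and> i \<le> a}
     in \<lparr>pverts = {..<2 * a + 2}, parcs = E \<union> E\<inverse>\<rparr>)"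

lemma caterpillar_simps:
  "pverts (caterpillar a) = {..<2 * a + 2}"
  "(u, v) \<in> parcs (caterpillar a) \<longleftrightarrow>
    u \<le> a \<and> v = u + 1 \<or> v \<le> a \<and> u = v + 1 \<or>
    1 \<le> u \<and> u \<le> a \<and> v = a + 1 + u \<or> 1 \<le> v \<and> v \<le> a \<and> u = a + 1 + v"
  by (auto simp: caterpillar_def Let_def)

lemma sym_caterpillar: "sym (parcs (caterpillar a))"
  by (rule symI) (auto simp: caterpillar_simps)

lemma pair_graph_caterpillar: "pair_graph (caterpillar a)"
proof -
  let ?G = "caterpillar a"
  have sub: "parcs ?G \<subseteq> pverts ?G \<times> pverts ?G"
    by (auto simp: caterpillar_simps)
  moreover have "finite (pverts ?G)" by (simp add: caterpillar_simps)
  ultimately have "finite (parcs ?G)" using finite_subset by blast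
  then show ?thesis
    using sub \<open>finite (pverts ?G)\<close> sym_caterpillar
    by unfold_locales (auto simp: symmetric_def caterpillar_simps(2))
qed

lemma connected_caterpillar: "Digraph_Component.connected (with_proj (caterpillar a))"
proof -
  interpret pair_graph "caterpillar a" by (rule pair_graph_caterpillar)
  have "\<exists>u \<in> pverts (caterpillar a). u < v \<and> (u, v) \<in> parcs (caterpillar a)"
    if "v \<in> pverts (caterpillar a)" "v \<noteq> 0" for v
    using that
    by (intro bexI[of _ "if v \<le> a + 1 then v - 1 else v - (a + 1)"]) (auto simp: caterpillar_simps)
  then have "Digraph_Component.connected (with_proj (caterpillar a) \<restriction> pverts (caterpillar a))"
    by (intro connected_induced_if_smaller_neighbor[OF sym_caterpillar, of 0])
      (auto simp: caterpillar_simps(1))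
  then show ?thesis by (simp only: induce_pverts)
qed

lemma connected_vertex_cover_spine:
  assumes "a \<ge> 1"
  shows "connected_vertex_cover (caterpillar a) {1..a}"
proof -
  have "\<exists>u \<in> {1..a}. u < v \<and> (u, v) \<in> parcs (caterpillar a)" if "v \<in> {1..a}" "v \<noteq> 1" for v
    using that by (intro bexI[of _ "v - 1"]) (auto simp: caterpillar_simps)
  then have "Digraph_Component.connected (with_proj (caterpillar a) \<restriction> {1..a})"
    using assms by (intro connected_induced_if_smaller_neighbor[OF sym_caterpillar, of 1]) auto
  then show ?thesis
    using assms by (auto simp: connected_vertex_cover_def vertex_cover_def caterpillar_simps)
qed

lemma caterpillar_degree: "card (open_neighborhood (caterpillar a) v) \<le> 3"
proof -
  have "open_neighborhood (caterpillar a) v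
      \<subseteq> {v - 1, v + 1, if v \<le> a then a + 1 + v else v - (a + 1)}"
    by (auto simp: open_neighborhood_def caterpillar_simps)
  then have "card (open_neighborhood (caterpillar a) v)
      \<le> card {v - 1, v + 1, if v \<le> a then a + 1 + v else v - (a + 1)}"
    by (intro card_mono) auto
  also have "\<dots> \<le> 3" by (simp add: card_insert_if)
  finally show ?thesis .
qed

lemma caterpillar_extremal:
  assumes "a \<ge> 1"
  shows "connected_cover_number (caterpillar a) = a"
    and "N_chromatic_number 3 (caterpillar a) = 2 * a + 2"
  using pair_graph.bounded_degree_extremal[OF pair_graph_caterpillar connected_caterpillar _ _
      connected_vertex_cover_spine[OF assms], of 2] caterpillar_degree
  by (simp_all add: caterpillar_simps(1))

theorem theorem2p3:
  shows "(\<forall>G :: 'a pair_pre_digraph.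
      pair_graph G \<and> Digraph_Component.connected (with_proj G) \<longrightarrow>
        (connected_cover_number G = 1 \<longrightarrow>
           N_chromatic_number 3 G \<le> 1 + 3 * connected_cover_number G) \<and>
        (connected_cover_number G = 2 \<longrightarrow>
           N_chromatic_number 3 G \<le> 3 * connected_cover_number G) \<and>
        (connected_cover_number G \<ge> 3 \<longrightarrow>
           N_chromatic_number 3 G \<le> 2 * connected_cover_number G + 2))
    \<and> (\<exists>G :: nat pair_pre_digraph.
      pair_graph G \<and> Digraph_Component.connected (with_proj G) \<and> connected_cover_number G = 1 \<and>
      N_chromatic_number 3 G = 1 + 3 * connected_cover_number G)
    \<and> (\<exists>G :: nat pair_pre_digraph.
      pair_graph G \<and> Digraph_Component.connected (with_proj G) \<and> connected_cover_number G = 2 \<and>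
      N_chromatic_number 3 G = 3 * connected_cover_number G)
    \<and> (\<exists>G :: nat pair_pre_digraph.
      pair_graph G \<and> Digraph_Component.connected (with_proj G) \<and> connected_cover_number G \<ge> 3 \<and>
      N_chromatic_number 3 G = 2 * connected_cover_number G + 2)"
proof (intro conjI allI impI)
  fix G :: "'a pair_pre_digraph"
  assume "pair_graph G \<and> Digraph_Component.connected (with_proj G)"
  then have bound: "N_chromatic_number 3 G \<le> 2 * connected_cover_number G + 2"
    using pair_graph.N_chromatic_number_le[of G 2] by simp
  show "N_chromatic_number 3 G \<le> 1 + 3 * connected_cover_number G"
    if "connected_cover_number G = 1" using bound that by simp
  show "N_chromatic_number 3 G \<le> 3 * connected_cover_number G"
    if "connected_cover_number G = 2" using bound that by simp
  show "N_chromatic_number 3 G \<le> 2 * connected_cover_number G + 2"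
    by (rule bound)
next
  show "\<exists>G :: nat pair_pre_digraph.
      pair_graph G \<and> Digraph_Component.connected (with_proj G) \<and> connected_cover_number G = 1 \<and>
      N_chromatic_number 3 G = 1 + 3 * connected_cover_number G"
    using pair_graph_caterpillar connected_caterpillar caterpillar_extremal[of 1]
    by (intro exI[of _ "caterpillar 1"]) simp
  show "\<exists>G :: nat pair_pre_digraph.
      pair_graph G \<and> Digraph_Component.connected (with_proj G) \<and> connected_cover_number G = 2 \<and>
      N_chromatic_number 3 G = 3 * connected_cover_number G"
    using pair_graph_caterpillar connected_caterpillar caterpillar_extremal[of 2]
    by (intro exI[of _ "caterpillar 2"]) simp
  show "\<exists>G :: nat pair_pre_digraph.
      pair_graph G \<and> Digraph_Component.connected (with_proj G) \<and> connected_cover_number G \<ge> 3 \<and>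
      N_chromatic_number 3 G = 2 * connected_cover_number G + 2"
    using pair_graph_caterpillar connected_caterpillar caterpillar_extremal[of 3]
    by (intro exI[of _ "caterpillar 3"]) simp
qed

end
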